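(* Let $L,L'$ be Lie algebras over a field $F$ and let $\varphi:L\to L'$ be a Lie algebra homomorphism. If $B=\mu_B$ is a complex fuzzy ideal of $L'$ with membership function $\mu_B(y)=r_B(y)e^{iw_B(y)}$, then the complex fuzzy set $\varphi^{-1}(B)$ is a complex fuzzy ideal of $L$.
   Context: A complex fuzzy set $A$ on a nonempty set $X$ is given by a membership function $\mu_A$ with values in the closed unit disc of the complex plane, represented as $\mu_A(x)=r_A(x)e^{iw_A(x)}$ with $r_A:X\to[0,1]$ and $w_A:X\to[0,2\pi]$ (the functions $r_A,w_A$ are part of the data, so a value is treated as a pair $(r,w)$). Values are compared by $r_1e^{iw_1}\le r_2e^{iw_2}$ iff $r_1\le r_2$ and $w_1\le w_2$; $\wedge$ and $\vee$ denote minimum and maximum, taken componentwise in $(r,w)$. $A$ is homogeneous if for all $x,y\in X$: $r_A(x)\le r_A(y)$ iff $w_A(x)\le w_A(y)$. The preimage of a complex fuzzy set $B$ on $Y$ under $f:X\to Y$ is the complex fuzzy set $f^{-1}(B)$ on $X$ with $\mu_{f^{-1}(B)}(x)=\mu_B(f(x))$. A complex fuzzy ideal of a Lie algebra $L$ over $F$ is a homogeneous complex fuzzy set $\mu_A$ on $L$ such that for all $x,y\in L$, $\alpha\in F$: (i) $\mu_A(x+y)\ge\mu_A(x)\wedge\mu_A(y)$; (ii) $\mu_A(\alpha x)\ge\mu_A(x)$; (iii) $\mu_A([x,y])\ge\mu_A(x)\vee\mu_A(y)$. *)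

theory Defs
  imports Complex_Main "HOL-Library.Product_Order"
begin

section \<open>Lie algebras\<close>

text \<open>The carrier of a Lie algebra is a whole type; its vector space structure is given by the
  scalar multiplication of the library locale.\<close>

locale lie_algebra = vector_space scale
  for scale :: "'f::field \<Rightarrow> 'a::ab_group_add \<Rightarrow> 'a" +
  fixes bracket :: "'a \<Rightarrow> 'a \<Rightarrow> 'a"
  assumes bracket_linear_left: "Vector_Spaces.linear scale scale (\<lambda>x. bracket x y)"
    and bracket_linear_right: "Vector_Spaces.linear scale scale (\<lambda>y. bracket x y)"
    and bracket_self: "bracket x x = 0"
    and jacobi:
      "bracket x (bracket y z) + bracket y (bracket z x) + bracket z (bracket x y) = 0"

locale lie_algebra_hom =
  dom: lie_algebra scale\<^sub>1 bracket\<^sub>1 + cod: lie_algebra scale\<^sub>2 bracket\<^sub>2 +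
  Vector_Spaces.linear scale\<^sub>1 scale\<^sub>2 \<phi>
  for scale\<^sub>1 :: "'f::field \<Rightarrow> 'a::ab_group_add \<Rightarrow> 'a"
    and bracket\<^sub>1 :: "'a \<Rightarrow> 'a \<Rightarrow> 'a"
    and scale\<^sub>2 :: "'f \<Rightarrow> 'b::ab_group_add \<Rightarrow> 'b"
    and bracket\<^sub>2 :: "'b \<Rightarrow> 'b \<Rightarrow> 'b"
    and \<phi> :: "'a \<Rightarrow> 'b" +
  assumes map_bracket: "\<phi> (bracket\<^sub>1 x y) = bracket\<^sub>2 (\<phi> x) (\<phi> y)"

section \<open>Complex fuzzy sets\<close>

text \<open>The amplitude and the phase are part of the data, so the value of a complex fuzzy set at a
  point is the pair \<open>(r, w)\<close> and not merely the complex number \<open>r e\<^sup>i\<^sup>w\<close> (which does not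
  determine \<open>w\<close> when \<open>r = 0\<close> or \<open>w \<in> {0, 2\<pi>}\<close>). On pairs of reals, the order and the operations
  \<open>inf\<close> and \<open>sup\<close> are the componentwise ones, i.e. componentwise minimum and maximum.\<close>

type_synonym 'a cfs = "'a \<Rightarrow> real \<times> real"

abbreviation amplitude :: "'a cfs \<Rightarrow> 'a \<Rightarrow> real" where
  "amplitude A x \<equiv> fst (A x)"

abbreviation phase :: "'a cfs \<Rightarrow> 'a \<Rightarrow> real" where
  "phase A x \<equiv> snd (A x)"

definition complex_fuzzy_set :: "'a cfs \<Rightarrow> bool" where
  "complex_fuzzy_set A \<longleftrightarrow>
     (\<forall>x. amplitude A x \<in> {0..1} \<and> phase A x \<in> {0..2 * pi})"

definition membership :: "'a cfs \<Rightarrow> 'a \<Rightarrow> complex" where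
  "membership A x = complex_of_real (amplitude A x) * exp (\<i> * complex_of_real (phase A x))"

definition homogeneous :: "'a cfs \<Rightarrow> bool" where
  "homogeneous A \<longleftrightarrow>
     (\<forall>x y. amplitude A x \<le> amplitude A y \<longleftrightarrow> phase A x \<le> phase A y)"

definition cfs_preimage :: "('a \<Rightarrow> 'b) \<Rightarrow> 'b cfs \<Rightarrow> 'a cfs" where
  "cfs_preimage f B = (\<lambda>x. B (f x))"

lemma norm_membership_le_1: "complex_fuzzy_set A \<Longrightarrow> norm (membership A x) \<le> 1"
  by (simp add: complex_fuzzy_set_def membership_def norm_mult)

lemma membership_cfs_preimage: "membership (cfs_preimage f B) x = membership B (f x)"
  by (simp add: membership_def cfs_preimage_def)

lemma cfs_value_ops:
  fixes r\<^sub>1 w\<^sub>1 r\<^sub>2 w\<^sub>2 :: real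
  shows "(r\<^sub>1, w\<^sub>1) \<le> (r\<^sub>2, w\<^sub>2) \<longleftrightarrow> r\<^sub>1 \<le> r\<^sub>2 \<and> w\<^sub>1 \<le> w\<^sub>2"
    and "inf (r\<^sub>1, w\<^sub>1) (r\<^sub>2, w\<^sub>2) = (min r\<^sub>1 r\<^sub>2, min w\<^sub>1 w\<^sub>2)"
    and "sup (r\<^sub>1, w\<^sub>1) (r\<^sub>2, w\<^sub>2) = (max r\<^sub>1 r\<^sub>2, max w\<^sub>1 w\<^sub>2)"
  by (simp_all add: inf_min sup_max)

section \<open>Complex fuzzy ideals\<close>

definition complex_fuzzy_ideal ::
  "('f \<Rightarrow> 'a::ab_group_add \<Rightarrow> 'a) \<Rightarrow> ('a \<Rightarrow> 'a \<Rightarrow> 'a) \<Rightarrow> 'a cfs \<Rightarrow> bool" where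
  "complex_fuzzy_ideal scale bracket A \<longleftrightarrow>
     complex_fuzzy_set A \<and> homogeneous A \<and>
     (\<forall>x y. A (x + y) \<ge> inf (A x) (A y)) \<and>
     (\<forall>\<alpha> x. A (scale \<alpha> x) \<ge> A x) \<and>
     (\<forall>x y. A (bracket x y) \<ge> sup (A x) (A y))"

end

theory Submission imports Defs begin

text \<open>The ideal conditions bound the value from below at a sum, scalar multiple or bracket by
  the values at its arguments. A Lie algebra homomorphism commutes with these three operations, so
  each such condition for the preimage at given points is the same condition for the original ideal at
  their images; the range and homogeneity conditions only concern attained values, so they survive
  composition with any map.\<close>

theorem theorem15:
  fixes scale\<^sub>L :: "'f::field \<Rightarrow> 'a::ab_group_add \<Rightarrow> 'a"
    and bracket\<^sub>L :: "'a \<Rightarrow> 'a \<Rightarrow> 'a"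
    and scale\<^sub>L' :: "'f \<Rightarrow> 'b::ab_group_add \<Rightarrow> 'b"
    and bracket\<^sub>L' :: "'b \<Rightarrow> 'b \<Rightarrow> 'b"
    and \<phi> :: "'a \<Rightarrow> 'b"
    and B :: "'b cfs"
  assumes "lie_algebra scale\<^sub>L bracket\<^sub>L"
    and "lie_algebra scale\<^sub>L' bracket\<^sub>L'"
    and "lie_algebra_hom scale\<^sub>L bracket\<^sub>L scale\<^sub>L' bracket\<^sub>L' \<phi>"
    and "complex_fuzzy_ideal scale\<^sub>L' bracket\<^sub>L' B"
  shows "complex_fuzzy_ideal scale\<^sub>L bracket\<^sub>L (cfs_preimage \<phi> B)"
proof -
  interpret lie_algebra_hom scale\<^sub>L bracket\<^sub>L scale\<^sub>L' bracket\<^sub>L' \<phi>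
    by (rule assms(3))
  show ?thesis
    using assms(4)
    by (simp add: complex_fuzzy_ideal_def complex_fuzzy_set_def homogeneous_def cfs_preimage_def
        add scale map_bracket)
qed

end
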